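(* Let $x_0\in M\setminus\{0\}$ and let $\hat A(x_0)=\Gamma_1\Gamma_2^{-1}$. Then the zero solution $y(t)\equiv 0$ of the linear system $\dot y(t)=\hat A(x_0)y(t)$ is Lyapunov stable. Furthermore, if the pair $(\hat A^\top(x_0),x_0^\top)$ is observable, then $\hat A(x_0)$ is Hurwitz.
   Context: Let $f:\mathbb{R}^n\to\mathbb{R}^n$ be smooth with $f(0)=0$, and consider $\dot x(t)=f(x(t))$, $x(0)=x_0$, with solution denoted $s(t,x_0)$. The origin is a locally exponentially stable equilibrium point with region of attraction $M\subseteq\mathbb{R}^n$, i.e. the set of $x_0$ for which $s(t,x_0)$ exists for all $t\ge 0$ and $s(t,x_0)\to0$ as $t\to\infty$. The Jacobian $A\triangleq f_x(0)$ is Hurwitz, and $g(x)\triangleq f(x)-Ax$ satisfies $g(x)=o(x)$, i.e. $\|g(x)\|/\|x\|\to0$ as $\|x\|\to0$. Standing assumption (persistency of excitation): solutions exist for all $t\ge0$ and the matrix $\int_0^\tau s(t,x_0)s(t,x_0)^\top\,\mathrm{d}t$ is positive definite for all $\tau>0$ and all $x_0\in\mathbb{R}^n\setminus\{0\}$. For $x_0\in M\setminus\{0\}$ define $$\Gamma_1=\int_0^\infty f(s(t,x_0))\,s(t,x_0)^\top\,\mathrm{d}t,\qquad \Gamma_2=\int_0^\infty s(t,x_0)\,s(t,x_0)^\top\,\mathrm{d}t .$$ A pair $(F,C)$ with $F\in\mathbb{R}^{n\times n}$, $C\in\mathbb{R}^{1\times n}$ is observable if the matrix with rows $C,CF,\dots,CF^{n-1}$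 has rank $n$. A square matrix is Hurwitz if all its eigenvalues have negative real part. *)

theory Defs
  imports "HOL-Analysis.Analysis"
begin

fun differentiable_of_order :: "nat \<Rightarrow> ('a::real_normed_vector \<Rightarrow> 'b::real_normed_vector) \<Rightarrow> bool"
  where
    "differentiable_of_order 0 f \<longleftrightarrow> continuous_on UNIV f"
  | "differentiable_of_order (Suc k) f \<longleftrightarrow>
       (\<forall>x. f differentiable (at x)) \<and>
       (\<forall>v. differentiable_of_order k (\<lambda>x. frechet_derivative f (at x) v))"

definition smooth :: "('a::real_normed_vector \<Rightarrow> 'b::real_normed_vector) \<Rightarrow> bool"
  where "smooth f \<longleftrightarrow> (\<forall>k. differentiable_of_order k f)"

text \<open>The derivative at time 0 is one-sided; values of \<open>x\<close> at negative times are irrelevant.\<close>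

definition ode_solution ::
    "('a::real_normed_vector \<Rightarrow> 'a) \<Rightarrow> 'a \<Rightarrow> (real \<Rightarrow> 'a) \<Rightarrow> bool"
  where "ode_solution f x\<^sub>0 x \<longleftrightarrow>
    x 0 = x\<^sub>0 \<and> (\<forall>t\<ge>0. (x has_vector_derivative f (x t)) (at t within {0..}))"

definition region_of_attraction ::
    "('a::real_normed_vector \<Rightarrow> 'a) \<Rightarrow> (real \<Rightarrow> 'a \<Rightarrow> 'a) \<Rightarrow> 'a set"
  where "region_of_attraction f s =
    {x\<^sub>0. ode_solution f x\<^sub>0 (\<lambda>t. s t x\<^sub>0) \<and> ((\<lambda>t. s t x\<^sub>0) \<longlongrightarrow> 0) at_top}"

definition locally_exponentially_stable :: "(real \<Rightarrow> 'a::real_normed_vector \<Rightarrow> 'a) \<Rightarrow> bool"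
  where "locally_exponentially_stable s \<longleftrightarrow>
    (\<exists>\<delta>>0. \<exists>K>0. \<exists>\<mu>>0. \<forall>x\<^sub>0. norm x\<^sub>0 < \<delta> \<longrightarrow>
       (\<forall>t\<ge>0. norm (s t x\<^sub>0) \<le> K * norm x\<^sub>0 * exp (- \<mu> * t)))"

text \<open>Every solution of a linear system with constant coefficients exists on \<open>{0..}\<close>, so
  quantifying over global solutions loses nothing here.\<close>

definition linear_lyapunov_stable :: "real^'n^'n \<Rightarrow> bool"
  where "linear_lyapunov_stable A \<longleftrightarrow>
    (\<forall>\<epsilon>>0. \<exists>\<delta>>0. \<forall>y\<^sub>0 y. ode_solution (\<lambda>v. A *v v) y\<^sub>0 y \<and> norm y\<^sub>0 < \<delta> \<longrightarrow>
       (\<forall>t\<ge>0. norm (y t) < \<epsilon>))"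

definition complex_eigenvalue :: "real^'n^'n \<Rightarrow> complex \<Rightarrow> bool"
  where "complex_eigenvalue A z \<longleftrightarrow>
    (\<exists>v :: complex^'n. v \<noteq> 0 \<and> map_matrix complex_of_real A *v v = z *s v)"

definition hurwitz :: "real^'n^'n \<Rightarrow> bool"
  where "hurwitz A \<longleftrightarrow> (\<forall>z. complex_eigenvalue A z \<longrightarrow> Re z < 0)"

definition positive_definite :: "real^'n^'n \<Rightarrow> bool"
  where "positive_definite P \<longleftrightarrow> transpose P = P \<and> (\<forall>v. v \<noteq> 0 \<longrightarrow> v \<bullet> (P *v v) > 0)"

text \<open>The type class power on \<open>real^'n^'n\<close> is componentwise, hence the iterate of \<open>(**)\<close>.\<close>

definition matrix_power :: "real^'n^'n \<Rightarrow> nat \<Rightarrow> real^'n^'n"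
  where "matrix_power F k = (((**) F) ^^ k) (mat 1)"

text \<open>The bijection \<open>to_nat_on UNIV\<close> from \<open>'n\<close> onto \<open>{..<CARD('n)}\<close> numbers the rows, so the rows
  are \<open>C F\<^sup>k\<close> for \<open>k < CARD('n)\<close> in some order, which does not affect the rank.\<close>

definition observability_matrix :: "real^'n^'n \<Rightarrow> real^'n^1 \<Rightarrow> real^'n^'n"
  where "observability_matrix F C =
    (\<chi> i. row 1 (C ** matrix_power F (to_nat_on (UNIV :: 'n set) i)))"

definition observable :: "real^'n^'n \<Rightarrow> real^'n^1 \<Rightarrow> bool"
  where "observable F C \<longleftrightarrow> rank (observability_matrix F C) = CARD('n)"

lemma rows_observability_matrix:
  fixes F :: "real^'n^'n"
  shows "rows (observability_matrix F C) = {row 1 (C ** matrix_power F k) | k. k < CARD('n)}"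
proof -
  have "bij_betw (to_nat_on (UNIV :: 'n set)) UNIV {..<CARD('n)}"
    by (rule to_nat_on_finite) simp
  then have "{..<CARD('n)} = range (to_nat_on (UNIV :: 'n set))"
    by (simp add: bij_betw_def)
  then have "k < CARD('n) \<longleftrightarrow> (\<exists>i. k = to_nat_on (UNIV :: 'n set) i)" for k
    by (metis lessThan_iff image_iff rangeI)
  then show ?thesis
    by (auto simp: rows_def row_def observability_matrix_def)
qed

definition outer_product :: "real^'n \<Rightarrow> real^'n \<Rightarrow> real^'n^'n"
  where "outer_product u v = (columnvector u :: real^1^'n) ** (rowvector v :: real^'n^1)"

definition \<Gamma>\<^sub>1 ::
    "(real^'n \<Rightarrow> real^'n) \<Rightarrow> (real \<Rightarrow> real^'n \<Rightarrow> real^'n) \<Rightarrow> real^'n \<Rightarrow> real^'n^'n"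
  where "\<Gamma>\<^sub>1 f s x\<^sub>0 = integral {0..} (\<lambda>t. outer_product (f (s t x\<^sub>0)) (s t x\<^sub>0))"

definition \<Gamma>\<^sub>2 :: "(real \<Rightarrow> real^'n \<Rightarrow> real^'n) \<Rightarrow> real^'n \<Rightarrow> real^'n^'n"
  where "\<Gamma>\<^sub>2 s x\<^sub>0 = integral {0..} (\<lambda>t. outer_product (s t x\<^sub>0) (s t x\<^sub>0))"

definition A_hat ::
    "(real^'n \<Rightarrow> real^'n) \<Rightarrow> (real \<Rightarrow> real^'n \<Rightarrow> real^'n) \<Rightarrow> real^'n \<Rightarrow> real^'n^'n"
  where "A_hat f s x\<^sub>0 = \<Gamma>\<^sub>1 f s x\<^sub>0 ** matrix_inv (\<Gamma>\<^sub>2 s x\<^sub>0)"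

end

theory Submission
  imports Defs
begin

text \<open>Along the trajectory \<open>x\<close>, which decays exponentially, \<open>x x\<^sup>T\<close> has derivative
  \<open>f(x) x\<^sup>T + x f(x)\<^sup>T\<close>, so integration gives \<open>\<Gamma>\<^sub>1 + \<Gamma>\<^sub>1\<^sup>T = - x\<^sub>0 x\<^sub>0\<^sup>T\<close>. Since \<open>\<Gamma>\<^sub>1\<close> is the product of
  the matrix in question, \<open>A\<close>, and \<open>\<Gamma>\<^sub>2\<close>, this is the Lyapunov equation
  \<open>A \<Gamma>\<^sub>2 + \<Gamma>\<^sub>2 A\<^sup>T = - x\<^sub>0 x\<^sub>0\<^sup>T\<close> with the positive definite solution \<open>\<Gamma>\<^sub>2\<close>. Stability follows with
  the Lyapunov function \<open>y\<^sup>T \<Gamma>\<^sub>2\<^sup>-\<^sup>1 y\<close>; observability excludes eigenvalues on the imaginary axis.\<close>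

section \<open>Uniqueness of solutions\<close>

text \<open>On the compact ball each directional derivative along a basis vector is bounded, and the
  sum of these bounds controls the operator norm. The ball is convex, so the mean value inequality
  applies.\<close>

lemma frechet_lipschitz_on_cball:
  fixes f :: "'a::euclidean_space \<Rightarrow> 'b::real_normed_vector"
  assumes diff: "\<And>x. f differentiable (at x)"
    and cont: "\<And>v. continuous_on UNIV (\<lambda>x. frechet_derivative f (at x) v)"
  obtains L where "L \<ge> 0"
    "\<And>x y. x \<in> cball 0 R \<Longrightarrow> y \<in> cball 0 R \<Longrightarrow> norm (f x - f y) \<le> L * norm (x - y)"
proof -
  let ?f' = "\<lambda>x. frechet_derivative f (at x)"
  have f': "(f has_derivative ?f' x) (at x)" for x
    using diff by (simp add: frechet_derivative_works)
  have "\<exists>B. \<forall>x\<in>cball 0 R. norm (?f' x i) \<le> B" for i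
  proof -
    have "compact ((\<lambda>x. ?f' x i) ` cball 0 R)"
      by (intro compact_continuous_image continuous_on_subset[OF cont]) auto
    then show ?thesis
      by (auto dest!: compact_imp_bounded simp: bounded_iff)
  qed
  then obtain B where B: "\<And>i x. x \<in> cball 0 R \<Longrightarrow> norm (?f' x i) \<le> B i"
    by metis
  define L where "L = \<bar>\<Sum>i\<in>Basis. B i\<bar>"
  have bound: "onorm (?f' x) \<le> L" if "x \<in> cball 0 R" for x
  proof -
    have "onorm (?f' x) \<le> (\<Sum>i\<in>Basis. norm (?f' x i))"
      using f' by (intro onorm_componentwise has_derivative_bounded_linear)
    also have "\<dots> \<le> (\<Sum>i\<in>Basis. B i)"
      using B that by (intro sum_mono) auto
    finally show ?thesis by (simp add: L_def)
  qed
  show ?thesis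
  proof
    show "L \<ge> 0" by (simp add: L_def)
    show "norm (f x - f y) \<le> L * norm (x - y)" if "x \<in> cball 0 R" "y \<in> cball 0 R" for x y
      using bound that by (intro differentiable_bound[of "cball 0 R" f ?f'])
        (auto intro: has_derivative_at_withinI[OF f'])
  qed
qed

lemma smooth_lipschitz_on_cball:
  fixes f :: "'a::euclidean_space \<Rightarrow> 'b::real_normed_vector"
  assumes "smooth f"
  obtains L where "L \<ge> 0"
    "\<And>x y. x \<in> cball 0 R \<Longrightarrow> y \<in> cball 0 R \<Longrightarrow> norm (f x - f y) \<le> L * norm (x - y)"
proof (rule frechet_lipschitz_on_cball)
  have "differentiable_of_order (Suc 0) f"
    using assms unfolding smooth_def by blast
  then show "f differentiable (at x)" "continuous_on UNIV (\<lambda>x. frechet_derivative f (at x) v)" for x v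
    by auto
qed (use that in blast)

lemma ode_solution_continuous_on:
  assumes "ode_solution f x\<^sub>0 u"
  shows "continuous_on {0..} u"
  using assms unfolding ode_solution_def
  by (intro continuous_on_vector_derivative) auto

lemma ode_solution_on_interval:
  assumes "ode_solution f x\<^sub>0 u" "t \<in> {0..T}"
  shows "(u has_vector_derivative f (u t)) (at t within {0..T})"
  using assms unfolding ode_solution_def
  by (auto intro: has_vector_derivative_within_subset)

lemma has_real_derivative_inner:
  fixes u v :: "real \<Rightarrow> 'a::real_inner"
  assumes "(u has_vector_derivative u') (at t within S)" "(v has_vector_derivative v') (at t within S)"
  shows "((\<lambda>t. u t \<bullet> v t) has_real_derivative (u t \<bullet> v' + u' \<bullet> v t)) (at t within S)"
  using has_derivative_inner[OF assms[unfolded has_vector_derivative_def]]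
  unfolding has_real_derivative_iff_has_vector_derivative has_vector_derivative_def
  by (simp add: algebra_simps)

text \<open>Derivatives are taken within the interval, so that this covers time 0, where a solution
  has only a one-sided derivative.\<close>

lemma DERIV_nonpos_within_imp_nonincreasing:
  fixes w :: "real \<Rightarrow> real"
  assumes "a \<le> b"
    and der: "\<And>t. t \<in> {a..b} \<Longrightarrow> (w has_real_derivative w' t) (at t within {a..b})"
    and nonpos: "\<And>t. t \<in> {a..b} \<Longrightarrow> w' t \<le> 0"
  shows "w b \<le> w a"
proof -
  obtain t where "t \<in> {a..b}" "w b - w a = (b - a) * w' t"
    using mvt_very_simple[OF \<open>a \<le> b\<close>, of w "\<lambda>t h. h * w' t"] der
    by (auto simp: has_field_derivative_def mult.commute mult_commute_abs)
  moreover have "(b - a) * w' t \<le> 0"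
    using \<open>a \<le> b\<close> nonpos \<open>t \<in> {a..b}\<close> by (intro mult_nonneg_nonpos) auto
  ultimately show ?thesis by simp
qed

text \<open>A Gronwall argument. Since \<open>f\<close> is Lipschitz only on bounded sets, a ball
  containing both trajectories up to time \<open>t\<close> is fixed first.\<close>

lemma ode_solution_unique:
  fixes f :: "'a::euclidean_space \<Rightarrow> 'a"
  assumes "smooth f" and u: "ode_solution f x\<^sub>0 u" and v: "ode_solution f x\<^sub>0 v" and "t \<ge> 0"
  shows "u t = v t"
proof -
  have "bounded (u ` {0..t})" "bounded (v ` {0..t})"
    using ode_solution_continuous_on[OF u] ode_solution_continuous_on[OF v]
    by (auto intro!: compact_imp_bounded compact_continuous_image elim: continuous_on_subset)
  then have "bounded (u ` {0..t} \<union> v ` {0..t})"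
    by simp
  then obtain R where "\<forall>y \<in> u ` {0..t} \<union> v ` {0..t}. norm y \<le> R"
    unfolding bounded_iff by blast
  then have R: "u r \<in> cball 0 R \<and> v r \<in> cball 0 R" if "r \<in> {0..t}" for r
    using that by simp
  obtain L where L: "L \<ge> 0"
    "\<And>x y. x \<in> cball 0 R \<Longrightarrow> y \<in> cball 0 R \<Longrightarrow> norm (f x - f y) \<le> L * norm (x - y)"
    using smooth_lipschitz_on_cball[OF \<open>smooth f\<close>] by blast
  define d where "d r = u r - v r" for r
  \<comment> \<open>The squared distance grows at most at rate \<open>2 * L\<close>; the exponential
    weight cancels this growth, so \<open>w\<close> cannot rise from its initial value 0.\<close>
  define w where "w r = (d r \<bullet> d r) * exp (- 2 * L * r)" for r
  define w' where "w' r = 2 * ((d r \<bullet> (f (u r) - f (v r))) - L * (d r \<bullet> d r)) * exp (- 2 * L * r)" for r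
  have "w t \<le> w 0"
  proof (rule DERIV_nonpos_within_imp_nonincreasing[OF \<open>t \<ge> 0\<close>])
    fix r assume r: "r \<in> {0..t}"
    have "(d has_vector_derivative (f (u r) - f (v r))) (at r within {0..t})"
      unfolding d_def using r
      by (intro has_vector_derivative_diff ode_solution_on_interval[OF u] ode_solution_on_interval[OF v])
    note has_real_derivative_inner[OF this this, derivative_intros]
    show "(w has_real_derivative w' r) (at r within {0..t})"
      unfolding w_def w'_def
      by (rule derivative_eq_intros refl | simp add: algebra_simps inner_commute)+
    have "d r \<bullet> (f (u r) - f (v r)) \<le> norm (d r) * norm (f (u r) - f (v r))"
      by (rule norm_cauchy_schwarz)
    also have "\<dots> \<le> norm (d r) * (L * norm (d r))"
      using L R[OF r] by (intro mult_left_mono) (auto simp: d_def)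
    also have "\<dots> = L * (d r \<bullet> d r)"
      by (simp add: dot_square_norm power2_eq_square)
    finally show "w' r \<le> 0"
      by (simp add: w'_def mult_le_0_iff)
  qed
  moreover have "w 0 = 0"
    using u v by (simp add: w_def d_def ode_solution_def)
  ultimately have "d t \<bullet> d t \<le> 0"
    by (simp add: w_def mult_le_0_iff)
  then have "d t = 0"
    by (metis inner_gt_zero_iff not_le)
  then show ?thesis
    by (simp add: d_def)
qed

section \<open>Exponential decay of trajectories in the region of attraction\<close>

lemma ode_solution_shift:
  assumes u: "ode_solution f x\<^sub>0 u" and "T \<ge> 0"
  shows "ode_solution f (u T) (\<lambda>t. u (T + t))"
proof -
  have "((\<lambda>t. u (T + t)) has_vector_derivative f (u (T + t))) (at t within {0..})" if "t \<ge> 0" for t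
  proof -
    \<comment> \<open>The chain rule asks for the derivative within the shifted half-line, which
      starts at \<open>T\<close> and lies in \<open>{0..}\<close> because \<open>T\<close> is
      nonnegative.\<close>
    have "(u has_vector_derivative f (u (T + t))) (at (T + t) within (+) T ` {0..})"
    proof (rule has_vector_derivative_within_subset)
      show "(u has_vector_derivative f (u (T + t))) (at (T + t) within {0..})"
        using u that \<open>T \<ge> 0\<close> by (simp add: ode_solution_def)
    qed (use \<open>T \<ge> 0\<close> in auto)
    moreover have "((+) T has_vector_derivative 1) (at t within {0..})"
      by (auto intro!: derivative_eq_intros)
    ultimately show ?thesis
      using vector_diff_chain_within[of "(+) T" 1 t "{0..}" u] by (simp add: o_def)
  qed
  then show ?thesis
    by (simp add: ode_solution_def)
qed

text \<open>A trajectory in the region of attraction enters the ball where the local exponential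
  estimate holds, and by uniqueness it coincides with the trajectory started there.\<close>

lemma region_of_attraction_exponential_decay:
  fixes f :: "'a::euclidean_space \<Rightarrow> 'a"
  assumes "smooth f" and sol: "\<And>x. ode_solution f x (\<lambda>t. s t x)"
    and "locally_exponentially_stable s" and "x\<^sub>0 \<in> region_of_attraction f s"
  obtains C \<mu> where "C \<ge> 0" "\<mu> > 0" "\<And>t. t \<ge> 0 \<Longrightarrow> norm (s t x\<^sub>0) \<le> C * exp (- \<mu> * t)"
proof -
  obtain \<delta> K \<mu> where "\<delta> > 0" "K > 0" "\<mu> > 0" and decay:
    "\<And>x t. norm x < \<delta> \<Longrightarrow> t \<ge> 0 \<Longrightarrow> norm (s t x) \<le> K * norm x * exp (- \<mu> * t)"
    using assms(3) unfolding locally_exponentially_stable_def by metis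
  have "((\<lambda>t. s t x\<^sub>0) \<longlongrightarrow> 0) at_top"
    using assms(4) by (simp add: region_of_attraction_def)
  then have "\<forall>\<^sub>F t in at_top. norm (s t x\<^sub>0) < \<delta> \<and> t \<ge> 0"
    using \<open>\<delta> > 0\<close> by (intro eventually_conj eventually_ge_at_top) (auto simp: tendsto_iff)
  then obtain T where T: "T \<ge> 0" "norm (s T x\<^sub>0) < \<delta>"
    by (auto simp: eventually_at_top_linorder)
  have "bounded ((\<lambda>t. s t x\<^sub>0) ` {0..T})"
    by (intro compact_imp_bounded compact_continuous_image
        continuous_on_subset[OF ode_solution_continuous_on[OF sol]]) auto
  then obtain B where B: "\<And>t. t \<in> {0..T} \<Longrightarrow> norm (s t x\<^sub>0) \<le> B"
    unfolding bounded_iff by blast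
  \<comment> \<open>\<open>B\<close> bounds the trajectory up to \<open>T\<close>, and
    \<open>K * \<delta>\<close> bounds the prefactor of the decay after \<open>T\<close>. The factor
    \<open>exp (\<mu> * T)\<close> compensates for decay being counted from \<open>T\<close> instead
    of 0.\<close>
  define C where "C = max B (K * \<delta>) * exp (\<mu> * T)"
  have "B \<ge> 0"
    using order_trans[OF norm_ge_zero B[of 0]] T by simp
  show ?thesis
  proof
    show "C \<ge> 0" using \<open>B \<ge> 0\<close> by (simp add: C_def le_max_iff_disj)
    show "\<mu> > 0" by fact
    fix t :: real assume "t \<ge> 0"
    show "norm (s t x\<^sub>0) \<le> C * exp (- \<mu> * t)"
    proof (cases "t \<le> T")
      case True
      then have "norm (s t x\<^sub>0) \<le> max B (K * \<delta>) * 1"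
        using B[of t] \<open>t \<ge> 0\<close> by simp
      also have "\<dots> \<le> max B (K * \<delta>) * exp (\<mu> * (T - t))"
        using True \<open>\<mu> > 0\<close> \<open>B \<ge> 0\<close> by (intro mult_left_mono) auto
      also have "\<dots> = C * exp (- \<mu> * t)"
        by (simp add: C_def right_diff_distrib exp_diff exp_minus field_simps)
      finally show ?thesis .
    next
      case False
      have "s t x\<^sub>0 = s (t - T) (s T x\<^sub>0)"
        using ode_solution_unique[OF \<open>smooth f\<close> ode_solution_shift[OF sol T(1)] sol, of "t - T"] False
        by simp
      also have "norm \<dots> \<le> K * norm (s T x\<^sub>0) * exp (- \<mu> * (t - T))"
        using decay[OF T(2)] False by simp
      also have "\<dots> \<le> max B (K * \<delta>) * exp (- \<mu> * (t - T))"
        using T \<open>K > 0\<close> by (intro mult_right_mono) (auto simp: le_max_iff_disj)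
      also have "\<dots> = C * exp (- \<mu> * t)"
        by (simp add: C_def right_diff_distrib exp_diff exp_minus field_simps)
      finally show ?thesis .
    qed
  qed
qed

section \<open>Improper integrals of exponentially decaying functions\<close>

lemma absolutely_integrable_exponential_decay:
  fixes h :: "real \<Rightarrow> 'a::euclidean_space"
  assumes "continuous_on {0..} h" and "\<mu> > 0"
    and "\<And>t. t \<ge> 0 \<Longrightarrow> norm (h t) \<le> D * exp (- \<mu> * t)"
  shows "h absolutely_integrable_on {0..}"
proof (rule measurable_bounded_by_integrable_imp_absolutely_integrable)
  show "h \<in> borel_measurable (lebesgue_on {0..})"
    using assms(1) by (intro continuous_imp_measurable_on_sets_lebesgue) auto
  show "(\<lambda>t. D * exp (- \<mu> * t)) integrable_on {0..}"
    using integrable_on_exp_minus_to_infinity[OF \<open>\<mu> > 0\<close>, of 0] by (rule integrable_on_mult_right)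
qed (use assms in auto)

text \<open>Absolute integrability makes the integrals over \<open>{a..b}\<close> converge to the
  one over \<open>{a..}\<close>; the fundamental theorem evaluates the former as
  \<open>F b - F a\<close>.\<close>

lemma integral_improper_FTC:
  fixes F :: "real \<Rightarrow> 'a::euclidean_space"
  assumes int: "h absolutely_integrable_on {a..}"
    and der: "\<And>t. t \<ge> a \<Longrightarrow> (F has_vector_derivative h t) (at t within {a..})"
    and lim: "(F \<longlongrightarrow> l) at_top"
  shows "integral {a..} h = l - F a"
proof -
  have "((\<lambda>b. LINT t:{a..b}|lebesgue. h t) \<longlongrightarrow> (LINT t:{a..}|lebesgue. h t)) at_top"
    using int by (intro tendsto_set_lebesgue_integral_at_top) auto
  moreover have "\<forall>\<^sub>F b in at_top. (LINT t:{a..b}|lebesgue. h t) = F b - F a"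
  proof (rule eventually_at_top_linorderI)
    fix b assume "b \<ge> a"
    have "h absolutely_integrable_on {a..b}"
      using int by (rule set_integrable_subset) auto
    then have "(LINT t:{a..b}|lebesgue. h t) = integral {a..b} h"
      by (rule set_lebesgue_integral_eq_integral(2))
    also have "\<dots> = F b - F a"
      using \<open>b \<ge> a\<close> by (intro integral_unique fundamental_theorem_of_calculus)
        (auto intro: has_vector_derivative_within_subset[OF der])
    finally show "(LINT t:{a..b}|lebesgue. h t) = F b - F a" .
  qed
  ultimately have "((\<lambda>b. F b - F a) \<longlongrightarrow> (LINT t:{a..}|lebesgue. h t)) at_top"
    by (simp cong: tendsto_cong)
  moreover have "((\<lambda>b. F b - F a) \<longlongrightarrow> l - F a) at_top"
    using lim by (intro tendsto_intros)
  ultimately have "(LINT t:{a..}|lebesgue. h t) = l - F a"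
    using tendsto_unique trivial_limit_at_top_linorder by blast
  then show ?thesis
    using set_lebesgue_integral_eq_integral(2)[OF int] by simp
qed

section \<open>Integrals of outer products\<close>

lemma outer_product_component: "outer_product a b $ i $ j = a $ i * b $ j"
  by (simp add: outer_product_def matrix_matrix_mult_def columnvector_def rowvector_def)

lemma inner_outer_product: "u \<bullet> (outer_product a b *v w) = (u \<bullet> a) * (b \<bullet> w)"
proof -
  have "outer_product a b *v w = (b \<bullet> w) *\<^sub>R a"
    by (simp add: vec_eq_iff matrix_vector_mult_def outer_product_component inner_vec_def
        sum_distrib_left mult_ac)
  then show ?thesis by simp
qed

text \<open>The norm of a matrix here is the Euclidean norm of its row norms, and row
  \<open>i\<close> is \<open>b\<close> scaled by \<open>a $ i\<close>, so the norm factors.\<close>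

lemma norm_outer_product_le:
  fixes a b :: "real^'n"
  shows "norm (outer_product a b) \<le> norm a * norm b"
proof -
  have "outer_product a b $ i = (a $ i) *\<^sub>R b" for i
    by (simp add: vec_eq_iff outer_product_component)
  then have "norm (outer_product a b) = L2_set (\<lambda>i. norm (a $ i) * norm b) UNIV"
    unfolding norm_vec_def[of "outer_product a b"] by simp
  also have "\<dots> = norm a * norm b"
    unfolding norm_vec_def[of a] by (simp add: L2_set_left_distrib)
  finally show ?thesis by simp
qed

lemma continuous_on_outer_product [continuous_intros]:
  fixes a b :: "'t::topological_space \<Rightarrow> real^'n"
  assumes "continuous_on S a" "continuous_on S b"
  shows "continuous_on S (\<lambda>t. outer_product (a t) (b t))"
  unfolding outer_product_def matrix_matrix_mult_def columnvector_def rowvector_def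
  using assms by (auto intro!: continuous_intros)

text \<open>Bounded linear maps commute with integration; through this one, the matrix integrals are
  handled as scalar integrals.\<close>

lemma bounded_linear_quadratic_entry: "bounded_linear (\<lambda>M :: real^'n^'n. u \<bullet> (M *v w))"
  unfolding linear_conv_bounded_linear[symmetric]
  by (rule linearI) (simp_all add: matrix_vector_mult_add_rdistrib inner_add_right
      scaleR_matrix_vector_assoc[symmetric])

lemma integral_outer_product:
  fixes a b :: "real \<Rightarrow> real^'n"
  assumes "(\<lambda>t. outer_product (a t) (b t)) integrable_on S"
  shows "u \<bullet> (integral S (\<lambda>t. outer_product (a t) (b t)) *v w) = integral S (\<lambda>t. (u \<bullet> a t) * (b t \<bullet> w))"
    and "(\<lambda>t. (u \<bullet> a t) * (b t \<bullet> w)) integrable_on S"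
  using integral_linear[OF assms bounded_linear_quadratic_entry[of u w]]
    integrable_linear[OF assms bounded_linear_quadratic_entry[of u w]]
  by (simp_all add: o_def inner_outer_product)

section \<open>The Lyapunov equation\<close>

lemma symmetric_matrix_iff_inner:
  fixes P :: "real^'n^'n"
  shows "transpose P = P \<longleftrightarrow> (\<forall>u w. u \<bullet> (P *v w) = w \<bullet> (P *v u))"
proof
  assume "transpose P = P"
  then show "\<forall>u w. u \<bullet> (P *v w) = w \<bullet> (P *v u)"
    by (metis dot_lmul_matrix inner_commute vector_transpose_matrix)
next
  assume *: "\<forall>u w. u \<bullet> (P *v w) = w \<bullet> (P *v u)"
  have "u \<bullet> (transpose P *v w) = u \<bullet> (P *v w)" for u w
    using * by (metis dot_lmul_matrix inner_commute transpose_matrix_vector)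
  then show "transpose P = P"
    by (metis matrix_eq vector_eq_ldot)
qed

lemma matrix_inv_right:
  fixes P :: "real^'n^'n"
  assumes "invertible P"
  shows "P ** matrix_inv P = mat 1"
  using someI_ex[OF assms[unfolded invertible_def]] by (simp_all add: matrix_inv_def)

text \<open>Positivity forces a trivial kernel, hence invertibility. The form of the inverse at
  \<open>u\<close>, \<open>w\<close> is the form of \<open>P\<close> at their preimages under
  \<open>P\<close>, so it inherits symmetry and positivity.\<close>

lemma positive_definite_inverse:
  fixes P :: "real^'n^'n"
  assumes "positive_definite P"
  shows "positive_definite (matrix_inv P)"
proof -
  have pos: "v \<bullet> (P *v v) > 0" if "v \<noteq> 0" for v
    using assms that by (simp add: positive_definite_def)
  have sym: "u \<bullet> (P *v w) = w \<bullet> (P *v u)" for u w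
    using assms symmetric_matrix_iff_inner[of P] by (simp add: positive_definite_def)
  have "invertible P"
  proof -
    have "v = 0" if "P *v v = 0" for v
      using pos[of v] that by force
    then show ?thesis
      using invertible_left_inverse matrix_left_invertible_ker by blast
  qed
  note inv = matrix_inv_right[OF this]
  have P: "P *v (matrix_inv P *v v) = v" for v
    using inv by (simp add: matrix_vector_mul_assoc)
  have "u \<bullet> (matrix_inv P *v w) = w \<bullet> (matrix_inv P *v u)" for u w
    using sym[of "matrix_inv P *v u" "matrix_inv P *v w"] by (simp add: P inner_commute)
  moreover have "v \<bullet> (matrix_inv P *v v) > 0" if "v \<noteq> 0" for v
  proof -
    have "matrix_inv P *v v \<noteq> 0"
      using P[of v] that by auto
    from pos[OF this] show ?thesis by (simp add: P inner_commute)
  qed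
  ultimately show ?thesis
    by (simp add: positive_definite_def symmetric_matrix_iff_inner)
qed

text \<open>The constant is the minimum of the quadratic form on the compact unit sphere;
  homogeneity of degree 2 carries the bound to all vectors.\<close>

lemma positive_definite_lower_bound:
  fixes Q :: "real^'n^'n"
  assumes "positive_definite Q"
  obtains c where "c > 0" "\<And>v. c * (norm v)\<^sup>2 \<le> v \<bullet> (Q *v v)"
proof -
  \<comment> \<open>An arbitrary coordinate vector shows that the sphere is nonempty, as attaining
    the infimum requires.\<close>
  have "axis undefined 1 \<in> sphere (0 :: real^'n) 1"
    by simp
  then have "\<exists>x\<in>sphere 0 1. \<forall>y\<in>sphere 0 1. x \<bullet> (Q *v x) \<le> y \<bullet> (Q *v y)"
    by (intro continuous_attains_inf continuous_intros
        linear_continuous_on_compose matrix_vector_mul_linear) auto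
  then obtain x where x: "norm x = 1" "\<And>y. norm y = 1 \<Longrightarrow> x \<bullet> (Q *v x) \<le> y \<bullet> (Q *v y)"
    by auto
  show ?thesis
  proof
    show "x \<bullet> (Q *v x) > 0"
      using assms x(1) unfolding positive_definite_def by (metis norm_zero zero_neq_one)
    fix v :: "real^'n"
    show "x \<bullet> (Q *v x) * (norm v)\<^sup>2 \<le> v \<bullet> (Q *v v)"
    proof (cases "v = 0")
      case False
      then have "x \<bullet> (Q *v x) \<le> (v /\<^sub>R norm v) \<bullet> (Q *v (v /\<^sub>R norm v))"
        by (intro x) simp
      then show ?thesis
        using False by (simp add: matrix_vector_mult_scaleR field_simps power2_eq_square)
    qed simp
  qed
qed

text \<open>The hypothesis \<open>lyap\<close> is the equation \<open>Q A + A\<^sup>T Q = - (Q b) (Q b)\<^sup>T\<close> for a positive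
  definite \<open>Q\<close>, written as an identity of bilinear forms.\<close>

lemma lyapunov_equation_imp_stable:
  fixes A Q :: "real^'n^'n"
  assumes "positive_definite Q"
    and lyap: "\<And>a c. (Q *v a) \<bullet> (A *v c) + (Q *v c) \<bullet> (A *v a) = - ((Q *v a) \<bullet> b) * ((Q *v c) \<bullet> b)"
  shows "linear_lyapunov_stable A"
proof -
  obtain c where c: "c > 0" "\<And>v. c * (norm v)\<^sup>2 \<le> v \<bullet> (Q *v v)"
    using positive_definite_lower_bound[OF assms(1)] by blast
  obtain K where K: "K > 0" "\<And>v. norm (Q *v v) \<le> norm v * K"
    using bounded_linear.pos_bounded[OF matrix_vector_mul_bounded_linear[of Q]] by blast
  have sym: "u \<bullet> (Q *v w) = w \<bullet> (Q *v u)" for u w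
    using assms(1) symmetric_matrix_iff_inner[of Q] by (simp add: positive_definite_def)
  \<comment> \<open>The Lyapunov function lies between \<open>c\<close> and \<open>K\<close> times
    the squared norm and does not increase along solutions.\<close>
  have bound: "c * (norm (y t))\<^sup>2 \<le> K * (norm y\<^sub>0)\<^sup>2"
    if y: "ode_solution (\<lambda>v. A *v v) y\<^sub>0 y" and "t \<ge> 0" for y\<^sub>0 y and t :: real
  proof -
    define V where "V r = y r \<bullet> (Q *v y r)" for r
    have "V t \<le> V 0"
    proof (rule DERIV_nonpos_within_imp_nonincreasing[OF \<open>t \<ge> 0\<close>])
      fix r assume "r \<in> {0..t}"
      then have y': "(y has_vector_derivative (A *v y r)) (at r within {0..t})"
        by (rule ode_solution_on_interval[OF y])
      then have "((\<lambda>r. Q *v y r) has_vector_derivative (Q *v (A *v y r))) (at r within {0..t})"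
        by (rule bounded_linear.has_vector_derivative[OF matrix_vector_mul_bounded_linear])
      from has_real_derivative_inner[OF y' this]
      show "(V has_real_derivative (- ((Q *v y r) \<bullet> b)\<^sup>2)) (at r within {0..t})"
        using lyap[of "y r" "y r"] sym[of "y r" "A *v y r"] unfolding V_def
        by (simp add: power2_eq_square inner_commute)
      show "- ((Q *v y r) \<bullet> b)\<^sup>2 \<le> 0" by simp
    qed
    also have "V 0 = y\<^sub>0 \<bullet> (Q *v y\<^sub>0)"
      using y by (simp add: V_def ode_solution_def)
    also have "\<dots> \<le> norm y\<^sub>0 * norm (Q *v y\<^sub>0)"
      by (rule norm_cauchy_schwarz)
    also have "\<dots> \<le> norm y\<^sub>0 * (norm y\<^sub>0 * K)"
      using K by (intro mult_left_mono) auto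
    finally show ?thesis
      using c(2)[of "y t"] by (simp add: V_def power2_eq_square mult_ac)
  qed
  show ?thesis
    unfolding linear_lyapunov_stable_def
  proof (intro allI impI)
    fix \<epsilon> :: real assume "\<epsilon> > 0"
    \<comment> \<open>Chosen so that
      \<open>K * \<delta>\<^sup>2 = c * \<epsilon>\<^sup>2\<close>.\<close>
    define \<delta> where "\<delta> = \<epsilon> * sqrt (c / K)"
    have "\<delta> > 0" using \<open>\<epsilon> > 0\<close> c K by (simp add: \<delta>_def)
    have "norm (y t) < \<epsilon>"
      if y: "ode_solution (\<lambda>v. A *v v) y\<^sub>0 y" and "norm y\<^sub>0 < \<delta>" "t \<ge> 0" for y\<^sub>0 y and t :: real
    proof -
      have "c * (norm (y t))\<^sup>2 \<le> K * (norm y\<^sub>0)\<^sup>2"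
        using bound y \<open>t \<ge> 0\<close> by blast
      also have "\<dots> < K * \<delta>\<^sup>2"
        using \<open>norm y\<^sub>0 < \<delta>\<close> K by (intro mult_strict_left_mono power_strict_mono) auto
      also have "\<dots> = c * \<epsilon>\<^sup>2"
        using c K by (simp add: \<delta>_def power_mult_distrib)
      finally have "(norm (y t))\<^sup>2 < \<epsilon>\<^sup>2"
        using c by simp
      then show ?thesis
        using \<open>\<epsilon> > 0\<close> power2_less_imp_less less_imp_le by blast
    qed
    then show "\<exists>\<delta>>0. \<forall>y\<^sub>0 y. ode_solution (\<lambda>v. A *v v) y\<^sub>0 y \<and> norm y\<^sub>0 < \<delta> \<longrightarrow>
       (\<forall>t\<ge>0. norm (y t) < \<epsilon>)"
      using \<open>\<delta> > 0\<close> by blast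
  qed
qed

section \<open>Observability and the spectrum\<close>

lemma complex_eigenvalue_real_parts:
  fixes A :: "real^'n^'n"
  assumes "complex_eigenvalue A z"
  obtains p q where "p \<noteq> 0 \<or> q \<noteq> 0"
    "A *v p = Re z *\<^sub>R p - Im z *\<^sub>R q" "A *v q = Im z *\<^sub>R p + Re z *\<^sub>R q"
proof -
  obtain v where v: "v \<noteq> 0" "map_matrix complex_of_real A *v v = z *s v"
    using assms unfolding complex_eigenvalue_def by blast
  \<comment> \<open>The entries of \<open>A\<close> are real, so taking real and imaginary parts of
    this equation gives the action of \<open>A\<close> on the two parts of the eigenvector.\<close>
  have eq: "(\<Sum>j\<in>UNIV. of_real (A $ i $ j) * v $ j) = z * v $ i" for i
    using v(2) by (simp add: vec_eq_iff matrix_vector_mult_def map_matrix_def)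
  show ?thesis
  proof
    show "(\<chi> i. Re (v $ i)) \<noteq> 0 \<or> (\<chi> i. Im (v $ i)) \<noteq> 0"
      using v(1) by (auto simp: vec_eq_iff complex_eq_iff)
    show "A *v (\<chi> i. Re (v $ i)) = Re z *\<^sub>R (\<chi> i. Re (v $ i)) - Im z *\<^sub>R (\<chi> i. Im (v $ i))"
      using arg_cong[OF eq, of Re] by (simp add: vec_eq_iff matrix_vector_mult_def)
    show "A *v (\<chi> i. Im (v $ i)) = Im z *\<^sub>R (\<chi> i. Re (v $ i)) + Re z *\<^sub>R (\<chi> i. Im (v $ i))"
      using arg_cong[OF eq, of Im] by (simp add: vec_eq_iff matrix_vector_mult_def)
  qed
qed

text \<open>A real form of the eigenvector test for observability. All powers of \<open>F\<close>
  keep \<open>p\<close> and \<open>q\<close> in their span, on which \<open>b\<close> vanishes, so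
  the observability matrix annihilates both; full rank makes it injective.\<close>

lemma observable_imp_no_invariant_plane:
  fixes F :: "real^'n^'n"
  assumes obs: "observable F (rowvector b)"
    and inv: "F *v p = \<alpha> *\<^sub>R p + \<beta> *\<^sub>R q" "F *v q = \<gamma> *\<^sub>R p + \<delta> *\<^sub>R q"
    and orth: "b \<bullet> p = 0" "b \<bullet> q = 0"
  shows "p = 0" "q = 0"
proof -
  have pow: "\<exists>c d. matrix_power F k *v r = c *\<^sub>R p + d *\<^sub>R q" if "r = p \<or> r = q" for k r
  proof (induction k)
    case 0
    have "r = 1 *\<^sub>R p + 0 *\<^sub>R q \<or> r = 0 *\<^sub>R p + 1 *\<^sub>R q"
      using that by simp
    then show ?case
      unfolding matrix_power_def by (simp del: scaleR_one scaleR_zero_left) blast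
  next
    case (Suc k)
    then obtain c d where "matrix_power F k *v r = c *\<^sub>R p + d *\<^sub>R q" by blast
    moreover have "matrix_power F (Suc k) *v r = F *v (matrix_power F k *v r)"
      by (simp add: matrix_power_def matrix_vector_mul_assoc)
    ultimately have "matrix_power F (Suc k) *v r
        = (c * \<alpha> + d * \<gamma>) *\<^sub>R p + (c * \<beta> + d * \<delta>) *\<^sub>R q"
      by (simp add: matrix_vector_right_distrib matrix_vector_mult_scaleR inv algebra_simps)
    then show ?case by blast
  qed
  have row: "row 1 (rowvector b ** M :: real^'n^1) \<bullet> r = b \<bullet> (M *v r)" for M :: "real^'n^'n" and r
  proof -
    have "row 1 (rowvector b ** M :: real^'n^1) = b v* M"
      by (simp add: vec_eq_iff row_def matrix_matrix_mult_def rowvector_def vector_matrix_mult_def mult.commute)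
    then show ?thesis by (simp add: dot_lmul_matrix)
  qed
  have "observability_matrix F (rowvector b) *v r = 0" if "r = p \<or> r = q" for r
  proof -
    have "(observability_matrix F (rowvector b) *v r) $ i = 0" for i
    proof -
      obtain c d where cd: "matrix_power F (to_nat_on UNIV i) *v r = c *\<^sub>R p + d *\<^sub>R q"
        using pow \<open>r = p \<or> r = q\<close> by blast
      show ?thesis
        by (simp add: matrix_vector_mul_component observability_matrix_def row cd orth inner_add_right)
    qed
    then show ?thesis by (simp add: vec_eq_iff)
  qed
  moreover have "inj ((*v) (observability_matrix F (rowvector b)))"
    using obs by (simp add: observable_def full_rank_injective)
  ultimately show "p = 0" "q = 0"
    by (metis injD matrix_vector_mult_0_right)+
qed

text \<open>An eigenvector \<open>a + i c\<close> with eigenvalue \<open>z\<close> turns the Lyapunov equation into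
  \<open>2 Re z (a\<^sup>T Q a + c\<^sup>T Q c) = - (b\<^sup>T Q a)\<^sup>2 - (b\<^sup>T Q c)\<^sup>2\<close>. If the right-hand side vanishes, then
  \<open>Q a\<close> and \<open>Q c\<close> span an \<open>A\<^sup>T\<close>-invariant subspace orthogonal to \<open>b\<close>.\<close>

lemma lyapunov_equation_observable_imp_hurwitz:
  fixes A Q :: "real^'n^'n"
  assumes "positive_definite Q"
    and lyap: "\<And>a c. (Q *v a) \<bullet> (A *v c) + (Q *v c) \<bullet> (A *v a) = - ((Q *v a) \<bullet> b) * ((Q *v c) \<bullet> b)"
    and obs: "observable (transpose A) (rowvector b)"
  shows "hurwitz A"
  unfolding hurwitz_def
proof (intro allI impI)
  fix z assume "complex_eigenvalue A z"
  then obtain a c where nz: "a \<noteq> 0 \<or> c \<noteq> 0"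
    and Aa: "A *v a = Re z *\<^sub>R a - Im z *\<^sub>R c" and Ac: "A *v c = Im z *\<^sub>R a + Re z *\<^sub>R c"
    by (rule complex_eigenvalue_real_parts)
  have sym: "(Q *v u) \<bullet> w = (Q *v w) \<bullet> u" for u w
    using assms(1) symmetric_matrix_iff_inner[of Q] by (simp add: positive_definite_def inner_commute)
  have Qpos: "(Q *v v) \<bullet> v \<ge> 0" "(Q *v v) \<bullet> v = 0 \<Longrightarrow> v = 0" for v
    using assms(1) unfolding positive_definite_def
    by (metis inner_commute inner_zero_left less_imp_le order_refl, metis inner_commute less_irrefl)
  \<comment> \<open>This is the Hermitian form of \<open>Q\<close> at the complex
    eigenvector.\<close>
  define N where "N = (Q *v a) \<bullet> a + (Q *v c) \<bullet> c"
  have "N > 0"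
    using nz Qpos[of a] Qpos[of c] unfolding N_def by linarith
  \<comment> \<open>Adding the two diagonal instances of \<open>lyap\<close> cancels the terms in
    \<open>Im z\<close>, by symmetry of \<open>Q\<close>.\<close>
  have energy: "2 * Re z * N = - ((Q *v a) \<bullet> b)\<^sup>2 - ((Q *v c) \<bullet> b)\<^sup>2"
    using lyap[of a a] lyap[of c c] sym[of a c] unfolding N_def Aa Ac
    by (simp add: inner_diff_right inner_add_right power2_eq_square algebra_simps)
  show "Re z < 0"
  proof (rule ccontr)
    assume "\<not> Re z < 0"
    then have "2 * Re z * N \<ge> 0"
      using \<open>N > 0\<close> by simp
    \<comment> \<open>A nonnegative quantity equals minus a sum of two squares, so both squares
      vanish, and then so does \<open>Re z\<close>.\<close>
    then have b: "(Q *v a) \<bullet> b = 0" "(Q *v c) \<bullet> b = 0"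
      using energy by (smt (verit) zero_le_power2 power2_eq_iff zero_eq_power2)+
    then have "Re z = 0"
      using energy \<open>N > 0\<close> by simp
    \<comment> \<open>If \<open>Q *v v\<close> is orthogonal to \<open>b\<close>, the right-hand
      side of \<open>lyap\<close> vanishes against every \<open>w\<close>, leaving an identity of
      vectors.\<close>
    have adj: "transpose A *v (Q *v v) = - (Q *v (A *v v))" if "(Q *v v) \<bullet> b = 0" for v
    proof -
      have "w \<bullet> (transpose A *v (Q *v v)) = w \<bullet> (- (Q *v (A *v v)))" for w
      proof -
        have "w \<bullet> (transpose A *v (Q *v v)) = (Q *v v) \<bullet> (A *v w)"
          by (metis dot_lmul_matrix inner_commute transpose_matrix_vector)
        also have "\<dots> = - ((Q *v w) \<bullet> (A *v v))"
          using lyap[of v w] that by simp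
        also have "\<dots> = w \<bullet> (- (Q *v (A *v v)))"
          by (simp only: sym[of w] inner_commute[of w] inner_minus_left)
        finally show ?thesis .
      qed
      then show ?thesis using vector_eq_ldot by blast
    qed
    have "transpose A *v (Q *v a) = 0 *\<^sub>R (Q *v a) + Im z *\<^sub>R (Q *v c)"
      "transpose A *v (Q *v c) = (- Im z) *\<^sub>R (Q *v a) + 0 *\<^sub>R (Q *v c)"
      unfolding adj[OF b(1)] adj[OF b(2)] Aa Ac \<open>Re z = 0\<close>
      by (simp_all add: matrix_vector_mult_scaleR vec.neg)
    from observable_imp_no_invariant_plane[OF obs this]
    have "Q *v a = 0" "Q *v c = 0"
      using b by (simp_all add: inner_commute)
    then show False
      using \<open>N > 0\<close> by (simp add: N_def)
  qed
qed

section \<open>The matrix \<open>\<Gamma>\<^sub>1 \<Gamma>\<^sub>2\<inverse>\<close>\<close>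

theorem theorem3:
  fixes f :: "real^'n \<Rightarrow> real^'n"
    and s :: "real \<Rightarrow> real^'n \<Rightarrow> real^'n"
    and x\<^sub>0 :: "real^'n"
  assumes "smooth f"
    and "f 0 = 0"
    and "\<forall>x. ode_solution f x (\<lambda>t. s t x)"
    and "locally_exponentially_stable s"
    and "hurwitz (jacobian f (at 0))"
    and "((\<lambda>x. norm (f x - jacobian f (at 0) *v x) / norm x) \<longlongrightarrow> 0) (at 0)"
    and "\<forall>\<tau>>0. \<forall>x. x \<noteq> 0 \<longrightarrow>
           positive_definite (integral {0..\<tau>} (\<lambda>t. outer_product (s t x) (s t x)))"
    and "x\<^sub>0 \<in> region_of_attraction f s - {0}"
  shows "linear_lyapunov_stable (A_hat f s x\<^sub>0) \<and>
    (observable (transpose (A_hat f s x\<^sub>0)) (rowvector x\<^sub>0 :: real^'n^1) \<longrightarrow>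
       hurwitz (A_hat f s x\<^sub>0))"
proof -
  define x where "x = (\<lambda>t. s t x\<^sub>0)"
  have sol: "ode_solution f x\<^sub>0 x"
    using assms(3) by (simp add: x_def)
  have x\<^sub>0: "x\<^sub>0 \<noteq> 0" "x\<^sub>0 \<in> region_of_attraction f s"
    using assms(8) by auto
  have "x 0 = x\<^sub>0" and x': "\<And>t. t \<ge> 0 \<Longrightarrow> (x has_vector_derivative f (x t)) (at t within {0..})"
    using sol by (auto simp: ode_solution_def)
  have x_lim: "(x \<longlongrightarrow> 0) at_top"
    using x\<^sub>0(2) by (simp add: region_of_attraction_def x_def)
  obtain C \<mu> where C: "C \<ge> 0" "\<mu> > 0" "\<And>t. t \<ge> 0 \<Longrightarrow> norm (x t) \<le> C * exp (- \<mu> * t)"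
    using region_of_attraction_exponential_decay[OF assms(1) _ assms(4) x\<^sub>0(2)] assms(3)
    unfolding x_def by blast
  obtain L where L: "L \<ge> 0"
    "\<And>y z. y \<in> cball 0 C \<Longrightarrow> z \<in> cball 0 C \<Longrightarrow> norm (f y - f z) \<le> L * norm (y - z)"
    using smooth_lipschitz_on_cball[OF assms(1)] by blast
  \<comment> \<open>The trajectory stays in the ball of radius \<open>C\<close>, as the exponential
    is at most 1. There \<open>f 0 = 0\<close> and the Lipschitz bound pass the decay of
    \<open>x\<close> on to \<open>f (x t)\<close>.\<close>
  have fx: "norm (f (x t)) \<le> L * (C * exp (- \<mu> * t))" if "t \<ge> 0" for t
  proof -
    have "norm (x t) \<le> C * exp (- \<mu> * t)" using C that by blast
    also have "\<dots> \<le> C * 1"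
      using C that by (intro mult_left_mono) auto
    finally have "x t \<in> cball 0 C" by simp
    then have "norm (f (x t) - f 0) \<le> L * norm (x t - 0)"
      using C by (intro L) auto
    also have "\<dots> \<le> L * (C * exp (- \<mu> * t))"
      using C L that by (intro mult_left_mono) auto
    finally show ?thesis by (simp add: assms(2))
  qed
  have cont_x: "continuous_on {0..} x"
    by (rule ode_solution_continuous_on[OF sol])
  have "differentiable_of_order 0 f"
    using assms(1) unfolding smooth_def by blast
  then have cont_fx: "continuous_on {0..} (\<lambda>t. f (x t))"
    using cont_x by (auto intro: continuous_on_compose2)
  \<comment> \<open>Each outer product has two decaying factors, so its norm decays at rate
    \<open>2 * \<mu>\<close>.\<close>
  have exp2: "exp (- \<mu> * t) * exp (- \<mu> * t) = exp (- (2 * \<mu>) * t)" for t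
    by (simp add: mult_exp_exp)
  have int1: "(\<lambda>t. outer_product (f (x t)) (x t)) absolutely_integrable_on {0..}"
  proof (rule absolutely_integrable_exponential_decay)
    fix t :: real assume "t \<ge> 0"
    have "norm (outer_product (f (x t)) (x t)) \<le> norm (f (x t)) * norm (x t)"
      by (rule norm_outer_product_le)
    also have "\<dots> \<le> (L * (C * exp (- \<mu> * t))) * (C * exp (- \<mu> * t))"
      using fx C L \<open>t \<ge> 0\<close> by (intro mult_mono) auto
    also have "\<dots> = (L * C * C) * exp (- (2 * \<mu>) * t)"
      unfolding exp2[symmetric] by (simp only: mult_ac)
    finally show "norm (outer_product (f (x t)) (x t)) \<le> (L * C * C) * exp (- (2 * \<mu>) * t)" .
  qed (use C in \<open>auto intro!: continuous_intros cont_x cont_fx\<close>)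
  have int2: "(\<lambda>t. outer_product (x t) (x t)) absolutely_integrable_on {0..}"
  proof (rule absolutely_integrable_exponential_decay)
    fix t :: real assume "t \<ge> 0"
    have "norm (outer_product (x t) (x t)) \<le> norm (x t) * norm (x t)"
      by (rule norm_outer_product_le)
    also have "\<dots> \<le> (C * exp (- \<mu> * t)) * (C * exp (- \<mu> * t))"
      using C \<open>t \<ge> 0\<close> by (intro mult_mono) auto
    also have "\<dots> = (C * C) * exp (- (2 * \<mu>) * t)"
      unfolding exp2[symmetric] by (simp only: mult_ac)
    finally show "norm (outer_product (x t) (x t)) \<le> (C * C) * exp (- (2 * \<mu>) * t)" .
  qed (use C in \<open>auto intro!: continuous_intros cont_x\<close>)
  note int1' = set_lebesgue_integral_eq_integral(1)[OF int1]
    and int2' = set_lebesgue_integral_eq_integral(1)[OF int2]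
  define P where "P = \<Gamma>\<^sub>2 s x\<^sub>0"
  define Q where "Q = matrix_inv P"
  have \<Gamma>\<^sub>1: "u \<bullet> (\<Gamma>\<^sub>1 f s x\<^sub>0 *v w) = integral {0..} (\<lambda>t. (u \<bullet> f (x t)) * (x t \<bullet> w))" for u w
    using integral_outer_product(1)[OF int1', of u w] by (simp add: \<Gamma>\<^sub>1_def x_def)
  have P: "u \<bullet> (P *v w) = integral {0..} (\<lambda>t. (u \<bullet> x t) * (x t \<bullet> w))" for u w
    using integral_outer_product(1)[OF int2', of u w] by (simp add: P_def \<Gamma>\<^sub>2_def x_def)
  have "positive_definite P"
  proof -
    have "u \<bullet> (P *v w) = w \<bullet> (P *v u)" for u w
      unfolding P by (simp add: inner_commute mult.commute)
    \<comment> \<open>Persistency of excitation gives positivity over \<open>{0..1}\<close>;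
      extending the integral to \<open>{0..}\<close> cannot lower it, because the integrand is a
      square.\<close>
    moreover have "v \<bullet> (P *v v) > 0" if "v \<noteq> 0" for v
    proof -
      have int01: "(\<lambda>t. outer_product (x t) (x t)) integrable_on {0..1}"
        using int2' by (rule integrable_on_subinterval) auto
      have "0 < v \<bullet> (integral {0..1} (\<lambda>t. outer_product (x t) (x t)) *v v)"
        using assms(7)[rule_format, of 1 x\<^sub>0] x\<^sub>0(1) that by (simp add: positive_definite_def x_def)
      also have "\<dots> = integral {0..1} (\<lambda>t. (v \<bullet> x t) * (x t \<bullet> v))"
        by (rule integral_outer_product(1)[OF int01])
      also have "\<dots> \<le> v \<bullet> (P *v v)"
        unfolding P
        by (intro integral_subset_le integral_outer_product(2) int01 int2') (auto simp: inner_commute)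
      finally show ?thesis .
    qed
    ultimately show ?thesis
      by (simp add: positive_definite_def symmetric_matrix_iff_inner)
  qed
  note Q = positive_definite_inverse[OF this, folded Q_def]
  have lyap: "u \<bullet> (\<Gamma>\<^sub>1 f s x\<^sub>0 *v w) + w \<bullet> (\<Gamma>\<^sub>1 f s x\<^sub>0 *v u) = - (u \<bullet> x\<^sub>0) * (w \<bullet> x\<^sub>0)" for u w
  proof -
    let ?h = "\<lambda>t. (u \<bullet> f (x t)) * (x t \<bullet> w) + (w \<bullet> f (x t)) * (x t \<bullet> u)"
    have abs: "(\<lambda>t. (a \<bullet> f (x t)) * (x t \<bullet> c)) absolutely_integrable_on {0..}" for a c
      using absolutely_integrable_linear[OF int1 bounded_linear_quadratic_entry[of a c]]
      by (simp add: o_def inner_outer_product)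
    \<comment> \<open>\<open>?h\<close> is the derivative of the product of
      \<open>u \<bullet> x t\<close> and \<open>w \<bullet> x t\<close>, which tends to 0; only the
      boundary term at time 0 survives.\<close>
    have "integral {0..} ?h = 0 - (u \<bullet> x 0) * (w \<bullet> x 0)"
    proof (rule integral_improper_FTC)
      show "?h absolutely_integrable_on {0..}"
        by (intro set_integral_add abs)
      have "((\<lambda>t. (u \<bullet> x t) * (w \<bullet> x t)) \<longlongrightarrow> (u \<bullet> 0) * (w \<bullet> 0)) at_top"
        by (intro tendsto_intros x_lim)
      then show "((\<lambda>t. (u \<bullet> x t) * (w \<bullet> x t)) \<longlongrightarrow> 0) at_top"
        by simp
      fix t :: real assume "t \<ge> 0"
      have in_der: "((\<lambda>t. a \<bullet> x t) has_real_derivative (a \<bullet> f (x t))) (at t within {0..})" for a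
        using has_real_derivative_inner[OF has_vector_derivative_const x'[OF \<open>t \<ge> 0\<close>], of a] by simp
      from DERIV_mult[OF in_der[of u] in_der[of w]]
      show "((\<lambda>t. (u \<bullet> x t) * (w \<bullet> x t)) has_vector_derivative ?h t) (at t within {0..})"
        by (simp add: has_real_derivative_iff_has_vector_derivative[symmetric] inner_commute)
    qed
    moreover have "integral {0..} ?h = u \<bullet> (\<Gamma>\<^sub>1 f s x\<^sub>0 *v w) + w \<bullet> (\<Gamma>\<^sub>1 f s x\<^sub>0 *v u)"
      unfolding \<Gamma>\<^sub>1 by (intro integral_add set_lebesgue_integral_eq_integral(1) abs)
    ultimately show ?thesis
      by (simp add: \<open>x 0 = x\<^sub>0\<close>)
  qed
  have A: "A_hat f s x\<^sub>0 *v v = \<Gamma>\<^sub>1 f s x\<^sub>0 *v (Q *v v)" for v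
    by (simp add: A_hat_def Q_def P_def matrix_vector_mul_assoc)
  \<comment> \<open>Putting \<open>u = Q *v a\<close> and \<open>w = Q *v c\<close> in
    \<open>lyap\<close> gives the form that the stability and Hurwitz lemmas expect, with
    \<open>b = x\<^sub>0\<close>.\<close>
  have "(Q *v a) \<bullet> (A_hat f s x\<^sub>0 *v c) + (Q *v c) \<bullet> (A_hat f s x\<^sub>0 *v a)
      = - ((Q *v a) \<bullet> x\<^sub>0) * ((Q *v c) \<bullet> x\<^sub>0)" for a c
    unfolding A by (rule lyap)
  then show ?thesis
    using lyapunov_equation_imp_stable[OF Q] lyapunov_equation_observable_imp_hurwitz[OF Q]
    by blast
qed

end
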